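(* Let $R$ be a ring and $B:=R[X_1,\ldots,X_n]$ the polynomial ring in $n$ variables over $R$. Let $\varphi:B\to B$ be a monomial $R$-retraction with image $A$. Let $\mathcal S_\varphi=\{i_1,\ldots,i_m\}\subseteq\{1,\ldots,n\}$ (with $|\mathcal S_\varphi|=m$), for some $0\le m\le n$. Then $A=R[e_1f_1,\ldots,e_mf_m]$ for some nonzero idempotent elements $e_1,\ldots,e_m\in R$ and polynomials $f_1,\ldots,f_m\in B$ such that the following assertions hold. (1) The polynomials $f_1,\ldots,f_m$ are monic monomials that are algebraically independent over $R$. (2) For each $j=1,\ldots,m$, $\varphi(X_{i_j})=\lambda_jf_j$ with $\lambda_j\in R$ such that $(\lambda_j)=(e_j)$ is a nonzero idempotent ideal, so that $A=R[\varphi(X_{i_1}),\ldots,\varphi(X_{i_m})]$; and each $f_j$ is of the form $X_{i_j}\cdot M_j$, where $M_j$ is a monomial and every variable that appears in $M_j$ is mapped to a nonzero element of $R$ under $\varphi$. (3) If $i\in\{1,\ldots,n\}\setminus\mathcal S_\varphi$, then either $\varphi(X_i)\in R$ or it is a nonzero monomial in $e_1f_1,\ldots,e_mf_m$. In particular, if $R$ does not contain any non-trivial idempotent elements, or if $\varphi$ is a monic monomial $R$-retraction, then $A=R^{[m]}$, for some $0\le m\le n$.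
   Context: All rings are commutative with unity. $R^{[m]}$ denotes the polynomial ring in $m$ variables over $R$ (so $A=R^{[m]}$ means that $A$ is a polynomial ring in $m$ variables over $R$). An $R$-retraction $\varphi:B\to B$ is an $R$-algebra homomorphism with $\varphi^2=\varphi$. A monomial of $B$ is a polynomial $\lambda X_1^{a_1}\cdots X_n^{a_n}$ with $0\neq\lambda\in R$ and $a_i$ non-negative integers (nonzero constants are monomials); it is monic if $\lambda=1$. An $R$-retraction $\varphi$ is a (monic) monomial $R$-retraction if $\varphi(X_i)$ is $0$ or a (monic) monomial for all $i$. The support of a monomial $R$-retraction $\varphi$ is $\mathcal S_\varphi:=\{i\in\{1,\ldots,n\}\mid \varphi(X_i)\text{ is a nonzero monomial that is divisible by }X_i\}$. An element $e\in R$ is idempotent if $e^2=e$, and non-trivial idempotent if moreover $e\ne 0,1$. A monomial in elements $g_1,\ldots,g_m$ is a product of an element of $R$ with powers of the $g_j$. *)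

theory Defs
  imports Complex_Main "HOL-Library.Poly_Mapping"
begin

(* Polynomials in the indeterminates X_0, X_1, X_2, ... over 'r, as finitely supported
   functions from exponent vectors to coefficients.  R[X_1,...,X_n] is the subring polys n. *)
type_synonym 'r mpol = "(nat \<Rightarrow>\<^sub>0 nat) \<Rightarrow>\<^sub>0 'r"

definition Const :: "'r::comm_ring_1 \<Rightarrow> 'r mpol" where
  "Const r = Poly_Mapping.single 0 r"

definition X :: "nat \<Rightarrow> 'r::comm_ring_1 mpol" where
  "X i = Poly_Mapping.single (Poly_Mapping.single i 1) 1"

definition indets :: "'r::comm_ring_1 mpol \<Rightarrow> nat set" where
  "indets p = (\<Union>t\<in>Poly_Mapping.keys p. Poly_Mapping.keys t)"

definition polys :: "nat \<Rightarrow> 'r::comm_ring_1 mpol set" where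
  "polys n = {p. indets p \<subseteq> {1..n}}"

definition is_monomial :: "nat \<Rightarrow> 'r::comm_ring_1 mpol \<Rightarrow> bool" where
  "is_monomial n p \<longleftrightarrow> (\<exists>c a. c \<noteq> 0 \<and> p = Const c * (\<Prod>i\<in>{1..n}. X i ^ a i))"

definition is_monic_monomial :: "nat \<Rightarrow> 'r::comm_ring_1 mpol \<Rightarrow> bool" where
  "is_monic_monomial n p \<longleftrightarrow> (\<exists>a. p = (\<Prod>i\<in>{1..n}. X i ^ a i))"

(* No condition c \<noteq> 0 here: a monomial in g_1,...,g_m may be 0, even for c \<noteq> 0, if the g_j
   are zero divisors. *)
definition is_monomial_in :: "nat \<Rightarrow> (nat \<Rightarrow> 'r::comm_ring_1 mpol) \<Rightarrow> 'r mpol \<Rightarrow> bool" where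
  "is_monomial_in m g p \<longleftrightarrow> (\<exists>c a. p = Const c * (\<Prod>j\<in>{1..m}. g j ^ a j))"

definition subalgebra :: "'r::comm_ring_1 mpol set \<Rightarrow> bool" where
  "subalgebra S \<longleftrightarrow> range Const \<subseteq> S \<and> (\<forall>p\<in>S. \<forall>q\<in>S. p + q \<in> S \<and> p * q \<in> S)"

definition adjoin :: "'r::comm_ring_1 mpol set \<Rightarrow> 'r mpol set" where
  "adjoin G = subalgebra hull G"

(* Only the values of h on the subalgebra D are constrained. *)
definition alg_hom_on :: "'r::comm_ring_1 mpol set \<Rightarrow> ('r mpol \<Rightarrow> 'r mpol) \<Rightarrow> bool" where
  "alg_hom_on D h \<longleftrightarrow> (\<forall>r. h (Const r) = Const r) \<and>
     (\<forall>p\<in>D. \<forall>q\<in>D. h (p + q) = h p + h q \<and> h (p * q) = h p * h q)"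

definition retraction :: "nat \<Rightarrow> ('r::comm_ring_1 mpol \<Rightarrow> 'r mpol) \<Rightarrow> bool" where
  "retraction n \<phi> \<longleftrightarrow> \<phi> ` polys n \<subseteq> polys n \<and> alg_hom_on (polys n) \<phi> \<and>
     (\<forall>p\<in>polys n. \<phi> (\<phi> p) = \<phi> p)"

definition monomial_retraction :: "nat \<Rightarrow> ('r::comm_ring_1 mpol \<Rightarrow> 'r mpol) \<Rightarrow> bool" where
  "monomial_retraction n \<phi> \<longleftrightarrow> retraction n \<phi> \<and>
     (\<forall>i\<in>{1..n}. \<phi> (X i) = 0 \<or> is_monomial n (\<phi> (X i)))"

definition monic_monomial_retraction :: "nat \<Rightarrow> ('r::comm_ring_1 mpol \<Rightarrow> 'r mpol) \<Rightarrow> bool" where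
  "monic_monomial_retraction n \<phi> \<longleftrightarrow> retraction n \<phi> \<and>
     (\<forall>i\<in>{1..n}. \<phi> (X i) = 0 \<or> is_monic_monomial n (\<phi> (X i)))"

definition support :: "nat \<Rightarrow> ('r::comm_ring_1 mpol \<Rightarrow> 'r mpol) \<Rightarrow> nat set" where
  "support n \<phi> = {i\<in>{1..n}. is_monomial n (\<phi> (X i)) \<and> (\<exists>q\<in>polys n. \<phi> (X i) = X i * q)}"

definition eval_at :: "(nat \<Rightarrow> 'r::comm_ring_1 mpol) \<Rightarrow> 'r mpol \<Rightarrow> 'r mpol" where
  "eval_at g P = (\<Sum>t\<in>Poly_Mapping.keys P. Const (Poly_Mapping.lookup P t) *
     (\<Prod>j\<in>Poly_Mapping.keys t. g j ^ Poly_Mapping.lookup t j))"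

definition alg_independent :: "nat \<Rightarrow> (nat \<Rightarrow> 'r::comm_ring_1 mpol) \<Rightarrow> bool" where
  "alg_independent m g \<longleftrightarrow> (\<forall>P\<in>polys m. eval_at g P = 0 \<longrightarrow> P = 0)"

definition is_polynomial_ring :: "'r::comm_ring_1 mpol set \<Rightarrow> nat \<Rightarrow> bool" where
  "is_polynomial_ring A m \<longleftrightarrow> (\<exists>\<psi>. bij_betw \<psi> (polys m) A \<and> alg_hom_on (polys m) \<psi>)"

(* Ideals are the submodules of the ring, regarded as a module over itself. *)
definition ideal_gen :: "'r::comm_ring_1 set \<Rightarrow> 'r set" where
  "ideal_gen S = module.span (*) S"

definition idempotent_ideal :: "'r::comm_ring_1 set \<Rightarrow> bool" where
  "idempotent_ideal I \<longleftrightarrow> module.subspace (*) I \<and> ideal_gen {a * b | a b. a \<in> I \<and> b \<in> I} = I"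

end

theory Submission
  imports Defs
begin

text \<open>Write \<open>\<phi> (X i) = lam i \<cdot> X^(ex i)\<close>. Comparing \<open>\<phi> (\<phi> (X i))\<close> with \<open>\<phi> (X i)\<close> shows that the exponents form an
  idempotent matrix \<open>p\<close> of natural numbers and that \<open>lam i = lam i * e i\<close>, where \<open>e i\<close> is the product
  of the \<open>lam k ^ p i k\<close>. If \<open>s\<close> lies in the support, then \<open>p s s = 1\<close> and every other variable in row
  \<open>s\<close> has a zero row, that is, a constant image; moreover \<open>lam s\<close> divides \<open>e s\<close>, so \<open>e s\<close> is an
  idempotent generating the ideal of \<open>lam s\<close>. Any nonzero row that is used by some row equals the row
  of an element of the support, so every \<open>\<phi> (X i)\<close> is a monomial in the \<open>e s \<cdot> X^(ex s)\<close>. These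
  monomials \<open>X^(ex s)\<close> are independent, since \<open>X s\<close> occurs in exactly one of them.\<close>

abbreviation lookup where "lookup \<equiv> Poly_Mapping.lookup"
abbreviation keys where "keys \<equiv> Poly_Mapping.keys"
abbreviation single where "single \<equiv> Poly_Mapping.single"

section \<open>Idempotent matrices of natural numbers\<close>

text \<open>The summand for \<open>k = i\<close> is \<open>p i i * p i l\<close>, already at least
  \<open>p i l\<close> because \<open>p i i\<close> is positive. Hence all other summands vanish,
  and \<open>l = i\<close> leaves \<open>p i i = p i i * p i i\<close>.\<close>

lemma idempotent_matrix_diag:
  fixes p :: "'a \<Rightarrow> 'a \<Rightarrow> nat"
  assumes fin: "finite N" and idem: "\<And>i l. i \<in> N \<Longrightarrow> p i l = (\<Sum>k\<in>N. p i k * p k l)"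
    and i: "i \<in> N" "p i i > 0"
  shows "p i i = 1" and "\<And>k l. k \<in> N \<Longrightarrow> k \<noteq> i \<Longrightarrow> p i k > 0 \<Longrightarrow> p k l = 0"
proof -
  have split: "p i l = p i i * p i l + (\<Sum>k\<in>N - {i}. p i k * p k l)" for l
    using idem[OF i(1), of l] by (simp add: sum.remove[OF fin i(1)])
  have zero: "(\<Sum>k\<in>N - {i}. p i k * p k l) = 0" for l
  proof -
    have "p i l \<le> p i i * p i l" using i(2) by simp
    with split[of l] show ?thesis by linarith
  qed
  show "p i i = 1"
    using split[of i] zero[of i] i(2) by simp
  fix k l assume "k \<in> N" "k \<noteq> i" "p i k > 0"
  moreover have "p i k * p k l = 0"
    using zero[of l] fin \<open>k \<in> N\<close> \<open>k \<noteq> i\<close> by (simp add: sum_nonneg_eq_0_iff)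
  ultimately show "p k l = 0" by simp
qed

text \<open>Give every index whose row is nonzero weight one, and the others weight zero. Then every
  nonzero row has weight at least one, and idempotency leaves no room for a row of weight two or
  more to be used by another row.\<close>

lemma idempotent_matrix_row:
  fixes p :: "'a \<Rightarrow> 'a \<Rightarrow> nat"
  assumes fin: "finite N" and idem: "\<And>i l. i \<in> N \<Longrightarrow> p i l = (\<Sum>k\<in>N. p i k * p k l)"
    and ik: "i \<in> N" "k \<in> N" "p i k > 0" and nz: "p k l0 > 0"
  obtains s where "s \<in> N" "p s s = 1" "p k s = 1" "\<And>l. p k l = p s l"
proof -
  define D where "D = {k\<in>N. \<exists>l. p k l > 0}"
  define w where "w k = (\<Sum>l\<in>D. p k l)" for k
  have finD: "finite D" and sub: "D \<subseteq> N" using fin by (auto simp: D_def)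
  have off: "p k l = 0" if "k \<in> N - D" for k l using that by (auto simp: D_def)
  have to_D: "(\<Sum>m\<in>N. p k m * p m l) = (\<Sum>m\<in>D. p k m * p m l)" for k l
    by (rule sum.mono_neutral_right) (use fin sub off in auto)
  \<comment> \<open>A positive entry \<open>p k l\<close> needs a positive summand
    \<open>p k m * p m l\<close>, and its factor \<open>p k m\<close> is counted in
    \<open>w k\<close>.\<close>
  have w_ge: "w k \<ge> 1" if k: "k \<in> D" for k
  proof -
    obtain l where "p k l > 0" using k by (auto simp: D_def)
    moreover have "p k l = (\<Sum>m\<in>D. p k m * p m l)" using idem[of k l] to_D k sub by auto
    ultimately obtain m where m: "m \<in> D" "p k m * p m l > 0"
      by (metis (no_types, lifting) gr_zeroI less_irrefl sum.neutral)
    have "p k m \<le> w k" unfolding w_def using finD m(1) by (intro member_le_sum) auto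
    with m(2) show ?thesis by (cases "p k m") auto
  qed
  have "w i = (\<Sum>l\<in>D. \<Sum>m\<in>D. p i m * p m l)"
    unfolding w_def by (rule sum.cong[OF refl], subst idem[OF ik(1)], rule to_D)
  also have "\<dots> = (\<Sum>m\<in>D. p i m * w m)"
    by (subst sum.swap) (simp add: w_def sum_distrib_left)
  finally have sums: "(\<Sum>m\<in>D. p i m) = (\<Sum>m\<in>D. p i m * w m)" by (simp add: w_def)
  have kD: "k \<in> D" using ik(2) nz by (auto simp: D_def)
  \<comment> \<open>By \<open>w_ge\<close> each summand on the right of \<open>sums\<close> is at
    least the one on the left, so equal totals force equality term by term, in particular at
    \<open>k\<close>.\<close>
  have "p i m \<le> p i m * w m" if "m \<in> D" for m using w_ge[OF that] by simp
  from sum_mono_inv[OF sums this kD finD] have "p i k = p i k * w k" .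
  hence "w k = 1" using ik(3) by simp
  hence "\<exists>s\<in>D. p k s = 1 \<and> (\<forall>m\<in>D. s \<noteq> m \<longrightarrow> p k m = 0)"
    by (simp only: w_def sum_eq_1_iff[OF finD])
  then obtain s where s: "s \<in> D" "p k s = 1" "\<And>m. m \<in> D \<Longrightarrow> m \<noteq> s \<Longrightarrow> p k m = 0" by metis
  \<comment> \<open>Inside \<open>D\<close> row \<open>k\<close> is the unit vector at
    \<open>s\<close>, so idempotency copies row \<open>s\<close> onto row \<open>k\<close>.\<close>
  have row: "p k l = p s l" for l
  proof -
    have zero: "(\<Sum>m\<in>D - {s}. p k m * p m l) = 0"
    proof (rule sum.neutral, rule ballI)
      fix m assume "m \<in> D - {s}"
      hence "p k m = 0" using s(3) by blast
      thus "p k m * p m l = 0" by simp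
    qed
    have "p k l = (\<Sum>m\<in>D. p k m * p m l)" using idem[OF ik(2), of l] to_D[of k l] by simp
    also have "\<dots> = p k s * p s l + (\<Sum>m\<in>D - {s}. p k m * p m l)"
      by (rule sum.remove[OF finD s(1)])
    finally show ?thesis by (simp add: zero s(2))
  qed
  from row[of s] s(2) have "p s s = 1" by simp
  with s(1,2) sub row show ?thesis by (intro that[of s]) blast+
qed

section \<open>Polynomials, evaluation and subalgebras\<close>

lemma single_eq_iff: "b \<noteq> 0 \<Longrightarrow> single s a = single t b \<longleftrightarrow> s = t \<and> a = b"
  by (metis keys_single lookup_single_eq singleton_inject empty_not_insert)

lemma sum_single_keys: "(\<Sum>t\<in>keys p. single t (lookup p t)) = p"
proof (rule poly_mapping_eqI)
  fix k
  show "lookup (\<Sum>t\<in>keys p. single t (lookup p t)) k = lookup p k"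
    by (simp add: lookup_sum lookup_single when_def sum.delta in_keys_iff)
qed

text \<open>The multiple of an exponent vector \<open>t\<close> by a natural number \<open>k\<close> is written \<open>of_nat k * t\<close>,
  the product being the convolution product of \<open>nat \<Rightarrow>\<^sub>0 nat\<close>.\<close>

lemma lookup_of_nat_mult: "lookup (of_nat k * t :: nat \<Rightarrow>\<^sub>0 nat) i = k * lookup t i"
  by (induction k) (simp_all add: lookup_add algebra_simps)

lemma single_power:
  "single (t :: nat \<Rightarrow>\<^sub>0 nat) (c :: 'r::comm_ring_1) ^ k = single (of_nat k * t) (c ^ k)"
  by (induction k) (simp_all add: mult_single algebra_simps)

lemma prod_single:
  "finite J \<Longrightarrow> (\<Prod>j\<in>J. single (t j :: nat \<Rightarrow>\<^sub>0 nat) (c j :: 'r::comm_ring_1)) =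
    single (\<Sum>j\<in>J. t j) (\<Prod>j\<in>J. c j)"
  by (induction J rule: finite_induct) (simp_all add: mult_single)

lemma Const_0 [simp]: "Const 0 = 0" and Const_1 [simp]: "Const 1 = 1"
  by (simp_all add: Const_def)

lemma Const_add: "Const (a + b) = Const a + Const b"
  by (simp add: Const_def single_add)

lemma Const_mult: "Const (a * b) = Const a * Const b"
  by (simp add: Const_def mult_single)

lemma Const_mult_single: "Const a * single t b = single t (a * b)"
  by (simp add: Const_def mult_single)

lemma X_power_prod:
  assumes "finite J"
  shows "(\<Prod>j\<in>J. (X j :: 'r::comm_ring_1 mpol) ^ a j) = single (\<Sum>j\<in>J. single j (a j)) 1"
proof -
  have "of_nat k * single j 1 = single j k" for j k :: nat
    by (rule poly_mapping_eqI) (simp add: lookup_of_nat_mult lookup_single when_def)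
  thus ?thesis using assms by (simp add: X_def single_power prod_single)
qed

lemma sum_single_nat:
  assumes "finite J" "keys t \<subseteq> J"
  shows "(\<Sum>j\<in>J. single j (lookup t j)) = (t :: nat \<Rightarrow>\<^sub>0 nat)"
  by (subst (2) sum_single_keys[of t, symmetric])
    (rule sum.mono_neutral_right, use assms in \<open>auto simp: in_keys_iff\<close>)

lemma keys_sum_single: "keys (\<Sum>j\<in>J. single j (a j :: nat)) \<subseteq> J"
proof
  fix k assume "k \<in> keys (\<Sum>j\<in>J. single j (a j))"
  hence "(\<Sum>j\<in>J. lookup (single j (a j)) k) \<noteq> 0" by (simp add: in_keys_iff lookup_sum)
  then obtain j where "j \<in> J" "lookup (single j (a j)) k \<noteq> 0" by (meson sum.neutral)
  thus "k \<in> J" by (auto simp: lookup_single when_def split: if_splits)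
qed

lemma is_monomial_iff:
  "is_monomial n p \<longleftrightarrow> (\<exists>t c. c \<noteq> 0 \<and> keys t \<subseteq> {1..n} \<and> p = single t c)"
proof
  assume "is_monomial n p"
  then obtain c a where "c \<noteq> 0" "p = Const c * (\<Prod>i\<in>{1..n}. X i ^ a i)"
    by (auto simp: is_monomial_def)
  hence "p = single (\<Sum>i\<in>{1..n}. single i (a i)) c"
    by (simp add: X_power_prod Const_mult_single)
  moreover have "keys (\<Sum>i\<in>{1..n}. single i (a i)) \<subseteq> {1..n}" by (rule keys_sum_single)
  ultimately show "\<exists>t c. c \<noteq> 0 \<and> keys t \<subseteq> {1..n} \<and> p = single t c"
    using \<open>c \<noteq> 0\<close> by blast
next
  assume "\<exists>t c. c \<noteq> 0 \<and> keys t \<subseteq> {1..n} \<and> p = single t c"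
  then obtain t c where "c \<noteq> 0" "keys t \<subseteq> {1..n}" "p = single t c" by blast
  hence "p = Const c * (\<Prod>i\<in>{1..n}. X i ^ lookup t i)"
    by (simp add: X_power_prod Const_mult_single sum_single_nat)
  with \<open>c \<noteq> 0\<close> show "is_monomial n p" unfolding is_monomial_def by blast
qed

lemma is_monic_monomial_iff:
  "is_monic_monomial n p \<longleftrightarrow> (\<exists>t. keys t \<subseteq> {1..n} \<and> p = single t 1)"
proof
  assume "is_monic_monomial n p"
  then obtain a where "p = (\<Prod>i\<in>{1..n}. X i ^ a i)" by (auto simp: is_monic_monomial_def)
  hence "p = single (\<Sum>i\<in>{1..n}. single i (a i)) 1" by (simp add: X_power_prod)
  moreover have "keys (\<Sum>i\<in>{1..n}. single i (a i)) \<subseteq> {1..n}" by (rule keys_sum_single)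
  ultimately show "\<exists>t. keys t \<subseteq> {1..n} \<and> p = single t 1" by blast
next
  assume "\<exists>t. keys t \<subseteq> {1..n} \<and> p = single t 1"
  then obtain t where "keys t \<subseteq> {1..n}" "p = single t 1" by blast
  hence "p = (\<Prod>i\<in>{1..n}. X i ^ lookup t i)" by (simp add: X_power_prod sum_single_nat)
  thus "is_monic_monomial n p" unfolding is_monic_monomial_def by blast
qed

section \<open>The subring of polynomials in \<open>n\<close> variables\<close>

lemma polys_iff: "p \<in> polys n \<longleftrightarrow> (\<forall>t\<in>keys p. keys t \<subseteq> {1..n})"
  by (auto simp: polys_def indets_def)

lemma single_in_polys: "keys t \<subseteq> {1..n} \<Longrightarrow> single t c \<in> polys n"
  by (auto simp: polys_iff)

lemma Const_in_polys [simp]: "Const c \<in> polys n"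
  by (auto simp: polys_iff Const_def)

lemma X_in_polys: "i \<in> {1..n} \<Longrightarrow> X i \<in> polys n"
  by (auto simp: polys_iff X_def)

lemma polys_add: "p \<in> polys n \<Longrightarrow> q \<in> polys n \<Longrightarrow> p + q \<in> polys n"
  unfolding polys_iff using keys_add[of p q] by blast

lemma polys_mult:
  assumes "p \<in> polys n" "q \<in> polys n"
  shows "p * q \<in> polys n"
  unfolding polys_iff
proof
  fix t assume "t \<in> keys (p * q)"
  then obtain a b where "t = a + b" "a \<in> keys p" "b \<in> keys q" using keys_mult[of p q] by blast
  thus "keys t \<subseteq> {1..n}" using assms keys_add[of a b] unfolding polys_iff by blast
qed

lemma polys_diff:
  assumes "p \<in> polys n" "q \<in> polys n"
  shows "p - q \<in> polys n"
proof -
  have "p - q = p + Const (- 1) * q" by (simp add: Const_def single_uminus)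
  also have "\<dots> \<in> polys n" using assms by (intro polys_add polys_mult Const_in_polys)
  finally show ?thesis .
qed

section \<open>Subalgebras and homomorphisms on them\<close>

lemma subalgebra_polys: "subalgebra (polys n)"
  by (auto simp: subalgebra_def polys_add polys_mult)

context
  fixes S :: "'r::comm_ring_1 mpol set"
  assumes S: "subalgebra S"
begin

lemma subalgebra_Const: "Const c \<in> S"
  using S by (auto simp: subalgebra_def)

lemma subalgebra_mult: "p \<in> S \<Longrightarrow> q \<in> S \<Longrightarrow> p * q \<in> S"
  using S by (auto simp: subalgebra_def)

lemma subalgebra_add: "p \<in> S \<Longrightarrow> q \<in> S \<Longrightarrow> p + q \<in> S"
  using S by (auto simp: subalgebra_def)

lemma subalgebra_power: "p \<in> S \<Longrightarrow> p ^ k \<in> S"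
  using subalgebra_Const[of 1] by (induction k) (auto intro: subalgebra_mult)

lemma subalgebra_prod: "(\<And>j. j \<in> J \<Longrightarrow> g j \<in> S) \<Longrightarrow> (\<Prod>j\<in>J. g j) \<in> S"
  using subalgebra_Const[of 1]
  by (induction J rule: infinite_finite_induct) (auto intro: subalgebra_mult)

lemma subalgebra_sum: "(\<And>j. j \<in> J \<Longrightarrow> g j \<in> S) \<Longrightarrow> (\<Sum>j\<in>J. g j) \<in> S"
  using subalgebra_Const[of 0]
  by (induction J rule: infinite_finite_induct) (auto intro: subalgebra_add)

lemma hom_prod:
  assumes h: "alg_hom_on S h" and g: "\<And>j. j \<in> J \<Longrightarrow> g j \<in> S"
  shows "h (\<Prod>j\<in>J. g j) = (\<Prod>j\<in>J. h (g j))"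
proof -
  have one: "h 1 = 1" using h by (metis Const_1 alg_hom_on_def)
  show ?thesis using g
    by (induction J rule: infinite_finite_induct)
      (use one h in \<open>simp_all add: alg_hom_on_def subalgebra_prod\<close>)
qed

lemma hom_power: "alg_hom_on S h \<Longrightarrow> p \<in> S \<Longrightarrow> h (p ^ k) = h p ^ k"
  using hom_prod[of h "{..<k}" "\<lambda>_. p"] by simp

lemma hom_sum:
  assumes h: "alg_hom_on S h" and g: "\<And>j. j \<in> J \<Longrightarrow> g j \<in> S"
  shows "h (\<Sum>j\<in>J. g j) = (\<Sum>j\<in>J. h (g j))"
proof -
  have zero: "h 0 = 0" using h by (metis Const_0 alg_hom_on_def)
  show ?thesis using g
    by (induction J rule: infinite_finite_induct)
      (use zero h in \<open>simp_all add: alg_hom_on_def subalgebra_sum\<close>)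
qed

end

lemma subalgebra_adjoin: "subalgebra (adjoin G)"
  unfolding adjoin_def by (rule hull_in) (auto simp: subalgebra_def)

lemma adjoin_inc: "g \<in> G \<Longrightarrow> g \<in> adjoin G"
  by (simp add: adjoin_def hull_inc)

lemma adjoin_minimal: "G \<subseteq> S \<Longrightarrow> subalgebra S \<Longrightarrow> adjoin G \<subseteq> S"
  by (simp add: adjoin_def hull_minimal)

lemma adjoin_subset: "G \<subseteq> adjoin H \<Longrightarrow> adjoin G \<subseteq> adjoin H"
  using adjoin_minimal subalgebra_adjoin by blast

section \<open>Evaluation at a family of elements\<close>

definition mon_eval :: "(nat \<Rightarrow> 'r::comm_ring_1 mpol) \<Rightarrow> (nat \<Rightarrow>\<^sub>0 nat) \<Rightarrow> 'r mpol" where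
  "mon_eval g t = (\<Prod>j\<in>keys t. g j ^ lookup t j)"

lemma mon_eval_superset:
  "finite J \<Longrightarrow> keys t \<subseteq> J \<Longrightarrow> mon_eval g t = (\<Prod>j\<in>J. g j ^ lookup t j)"
  unfolding mon_eval_def by (rule prod.mono_neutral_left) (auto simp: in_keys_iff)

lemma mon_eval_add: "mon_eval g (s + t) = mon_eval g s * mon_eval g t"
proof -
  let ?J = "keys s \<union> keys t"
  have "keys (s + t) \<subseteq> ?J" by (rule keys_add)
  thus ?thesis
    by (simp add: mon_eval_superset[of ?J] lookup_add power_add prod.distrib)
qed

text \<open>Exponent vectors outside \<open>keys P\<close> have coefficient \<open>0\<close>.
  Cancellation can make \<open>keys (P + Q)\<close> smaller than the union of the keys, so sums are
  compared over a common superset.\<close>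

lemma eval_at_superset:
  assumes "finite K" "keys P \<subseteq> K"
  shows "eval_at g P = (\<Sum>t\<in>K. Const (lookup P t) * mon_eval g t)"
  unfolding eval_at_def mon_eval_def[symmetric]
  by (rule sum.mono_neutral_left) (use assms in \<open>auto simp: in_keys_iff\<close>)

lemma eval_at_add: "eval_at g (P + Q) = eval_at g P + eval_at g Q"
proof -
  let ?K = "keys P \<union> keys Q"
  have "keys (P + Q) \<subseteq> ?K" by (rule keys_add)
  thus ?thesis
    by (simp add: eval_at_superset[of ?K] lookup_add Const_add distrib_right sum.distrib)
qed

lemma eval_at_single: "eval_at g (single t c) = Const c * mon_eval g t"
  by (simp add: eval_at_superset[of "{t}"])

lemma eval_at_Const: "eval_at g (Const c) = Const c"
  unfolding Const_def[of c] eval_at_single by (simp add: mon_eval_def Const_def)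

lemma eval_at_X: "eval_at g (X i) = g i"
  by (simp add: X_def eval_at_single mon_eval_def)

lemma eval_at_sum: "eval_at g (\<Sum>j\<in>J. F j) = (\<Sum>j\<in>J. eval_at g (F j))"
  using eval_at_Const[of g 0]
  by (induction J rule: infinite_finite_induct) (simp_all add: eval_at_add)

text \<open>Both sides are additive in \<open>P\<close> and in \<open>Q\<close>, so the claim
  reduces to two single terms, where exponent vectors add.\<close>

lemma eval_at_mult: "eval_at g (P * Q) = eval_at g P * eval_at g Q"
proof -
  have *: "eval_at g (single s a * single t b) = eval_at g (single s a) * eval_at g (single t b)"
    for s t a b
    by (simp add: mult_single eval_at_single mon_eval_add Const_mult mult_ac)
  have "eval_at g (P * Q) = eval_at g ((\<Sum>s\<in>keys P. single s (lookup P s)) *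
      (\<Sum>t\<in>keys Q. single t (lookup Q t)))"
    by (simp add: sum_single_keys)
  also have "\<dots> = eval_at g (\<Sum>s\<in>keys P. single s (lookup P s)) *
      eval_at g (\<Sum>t\<in>keys Q. single t (lookup Q t))"
    by (simp only: sum_product eval_at_sum *)
  finally show ?thesis by (simp add: sum_single_keys)
qed

lemma alg_hom_on_eval_at: "alg_hom_on D (eval_at g)"
  by (simp add: alg_hom_on_def eval_at_Const eval_at_add eval_at_mult)

text \<open>The universal property: every polynomial is a sum of constants times products of
  variables, so the images of the variables determine \<open>h\<close>. The identity is limited to
  \<open>polys n\<close>, where alone \<open>h\<close> is constrained.\<close>

lemma hom_eq_eval_at:
  fixes h :: "'r::comm_ring_1 mpol \<Rightarrow> 'r mpol"
  assumes h: "alg_hom_on (polys n) h" and p: "p \<in> polys n"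
  shows "h p = eval_at (\<lambda>i. h (X i)) p"
proof -
  note S = subalgebra_polys[of n]
  \<comment> \<open>Membership is proved along with the value, because \<open>hom_sum\<close>
    requires each term to lie in \<open>polys n\<close>.\<close>
  have mono: "single t c \<in> polys n \<and> h (single t c) = Const c * mon_eval (\<lambda>i. h (X i)) t"
    if t: "keys t \<subseteq> {1..n}" for t c
  proof -
    have eq: "single t c = Const c * (\<Prod>i\<in>{1..n}. X i ^ lookup t i)"
      using t by (simp add: X_power_prod Const_mult_single sum_single_nat)
    have pr: "X i ^ lookup t i \<in> (polys n :: 'r mpol set)" if "i \<in> {1..n}" for i
      using that by (intro subalgebra_power[OF S] X_in_polys)
    have "(\<Prod>i\<in>{1..n}. X i ^ lookup t i) \<in> (polys n :: 'r mpol set)" by (rule subalgebra_prod[OF S pr])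
    hence "h (single t c) = Const c * h (\<Prod>i\<in>{1..n}. X i ^ lookup t i)"
      using h unfolding eq alg_hom_on_def by simp
    also have "h (\<Prod>i\<in>{1..n}. X i ^ lookup t i) = (\<Prod>i\<in>{1..n}. h (X i ^ lookup t i))"
      by (rule hom_prod[OF S h pr])
    also have "(\<Prod>i\<in>{1..n}. h (X i ^ lookup t i)) = mon_eval (\<lambda>i. h (X i)) t"
      by (simp add: mon_eval_superset[OF _ t] hom_power[OF S h] X_in_polys)
    finally show ?thesis using t by (simp add: single_in_polys)
  qed
  have "h p = h (\<Sum>t\<in>keys p. single t (lookup p t))" by (simp add: sum_single_keys)
  also have "\<dots> = (\<Sum>t\<in>keys p. h (single t (lookup p t)))"
    by (rule hom_sum[OF S h]) (use mono p in \<open>auto simp: polys_iff\<close>)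
  also have "\<dots> = (\<Sum>t\<in>keys p. Const (lookup p t) * mon_eval (\<lambda>i. h (X i)) t)"
    by (rule sum.cong[OF refl]) (use mono p in \<open>auto simp: polys_iff\<close>)
  finally show ?thesis by (simp add: eval_at_def mon_eval_def)
qed

text \<open>The values of \<open>eval_at g\<close> form a subalgebra containing the
  \<open>g j\<close>, which gives one inclusion. Conversely, each value is built from constants and
  the \<open>g j\<close> by sums and products.\<close>

lemma eval_at_image: "eval_at g ` polys m = adjoin (g ` {1..m})"
proof
  show "adjoin (g ` {1..m}) \<subseteq> eval_at g ` polys m"
  proof (rule adjoin_minimal)
    show "g ` {1..m} \<subseteq> eval_at g ` polys m"
      using X_in_polys eval_at_X by (metis image_eqI image_subsetI)
    show "subalgebra (eval_at g ` polys m)"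
      unfolding subalgebra_def
    proof (intro conjI ballI)
      show "range Const \<subseteq> eval_at g ` polys m"
        by (metis Const_in_polys eval_at_Const image_eqI image_subsetI)
    next
      fix p q assume "p \<in> eval_at g ` polys m" "q \<in> eval_at g ` polys m"
      then obtain P Q where "P \<in> polys m" "p = eval_at g P" "Q \<in> polys m" "q = eval_at g Q"
        by blast
      thus "p + q \<in> eval_at g ` polys m" "p * q \<in> eval_at g ` polys m"
        by (metis polys_add eval_at_add image_eqI, metis polys_mult eval_at_mult image_eqI)
    qed
  qed
  show "eval_at g ` polys m \<subseteq> adjoin (g ` {1..m})"
  proof
    fix p assume "p \<in> eval_at g ` polys m"
    then obtain P where P: "P \<in> polys m" "p = eval_at g P" by blast
    note S = subalgebra_adjoin[of "g ` {1..m}"]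
    have "g j \<in> adjoin (g ` {1..m})" if "t \<in> keys P" "j \<in> keys t" for t j
      using that P(1) by (intro adjoin_inc) (auto simp: polys_iff)
    thus "p \<in> adjoin (g ` {1..m})"
      unfolding P(2) eval_at_def
      by (intro subalgebra_sum[OF S] subalgebra_mult[OF S] subalgebra_Const[OF S]
          subalgebra_prod[OF S] subalgebra_power[OF S])
  qed
qed

lemma hom_image:
  assumes "alg_hom_on (polys n) h"
  shows "h ` polys n = adjoin ((\<lambda>i. h (X i)) ` {1..n})"
proof -
  have "h ` polys n = eval_at (\<lambda>i. h (X i)) ` polys n"
    by (rule image_cong[OF refl]) (rule hom_eq_eval_at[OF assms])
  thus ?thesis by (simp add: eval_at_image)
qed

section \<open>Algebraic independence\<close>

lemma alg_independent_is_polynomial_ring: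
  assumes "alg_independent m f"
  shows "is_polynomial_ring (adjoin (f ` {1..m})) m"
  unfolding is_polynomial_ring_def
proof (intro exI conjI)
  show "alg_hom_on (polys m) (eval_at f)" by (rule alg_hom_on_eval_at)
  \<comment> \<open>Independence says that only \<open>0\<close> evaluates to \<open>0\<close>;
    applied to differences, this is injectivity.\<close>
  have "inj_on (eval_at f) (polys m)"
  proof (rule inj_onI)
    fix P Q assume PQ: "P \<in> polys m" "Q \<in> polys m" "eval_at f P = eval_at f Q"
    have "eval_at f (P - Q) = 0" using eval_at_add[of f "P - Q" Q] PQ(3) by simp
    with assms polys_diff[OF PQ(1,2)] have "P - Q = 0" unfolding alg_independent_def by blast
    thus "P = Q" by simp
  qed
  thus "bij_betw (eval_at f) (polys m) (adjoin (f ` {1..m}))"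
    by (simp add: bij_betw_def eval_at_image)
qed

text \<open>The index \<open>x k\<close> marks \<open>f k\<close>: it occurs there with exponent 1
  and in no other \<open>f j\<close>. So the exponents of a product of powers of the
  \<open>f j\<close> can be read off at the marks, distinct products are distinct monomials, and
  nothing cancels in \<open>eval_at f P\<close>.\<close>

lemma monomials_alg_independent:
  fixes f :: "nat \<Rightarrow> 'r::comm_ring_1 mpol"
  assumes f: "\<And>j. j \<in> {1..m} \<Longrightarrow> f j = single (a j) 1"
    and a: "\<And>j k. j \<in> {1..m} \<Longrightarrow> k \<in> {1..m} \<Longrightarrow> lookup (a j) (x k) = (if j = k then 1 else 0)"
  shows "alg_independent m f"
  unfolding alg_independent_def
proof (intro ballI impI)
  fix P assume P: "P \<in> polys m" and eval: "eval_at f P = 0"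
  \<comment> \<open>\<open>T t\<close> is the exponent vector of the product of the
    \<open>f j ^ lookup t j\<close>.\<close>
  define T where "T t = (\<Sum>j\<in>{1..m}. of_nat (lookup t j) * a j)" for t :: "nat \<Rightarrow>\<^sub>0 nat"
  have lookup_T: "lookup (T t) (x k) = lookup t k" if "k \<in> {1..m}" for t k
  proof -
    have "lookup (T t) (x k) = (\<Sum>j\<in>{1..m}. lookup t j * (if j = k then 1 else 0))"
      unfolding T_def lookup_sum lookup_of_nat_mult
      by (rule sum.cong[OF refl]) (simp only: a[OF _ that])
    also have "\<dots> = lookup t k" using that by (simp add: if_distrib sum.delta cong: if_cong)
    finally show ?thesis .
  qed
  have inj: "inj_on T (keys P)"
  proof (rule inj_onI, rule poly_mapping_eqI)
    fix s t k assume st: "s \<in> keys P" "t \<in> keys P" "T s = T t"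
    show "lookup s k = lookup t k"
    proof (cases "k \<in> {1..m}")
      case True
      thus ?thesis using lookup_T[of k s] lookup_T[of k t] st(3) by simp
    next
      case False
      with st(1,2) P have "k \<notin> keys s" "k \<notin> keys t" unfolding polys_iff by blast+
      thus ?thesis by (simp add: in_keys_iff)
    qed
  qed
  have mon: "mon_eval f t = single (T t) 1" if "t \<in> keys P" for t
  proof -
    have "keys t \<subseteq> {1..m}" using that P by (auto simp: polys_iff)
    hence "mon_eval f t = (\<Prod>j\<in>{1..m}. f j ^ lookup t j)"
      by (rule mon_eval_superset[OF finite_atLeastAtMost])
    also have "\<dots> = (\<Prod>j\<in>{1..m}. single (a j) 1 ^ lookup t j)"
      by (rule prod.cong[OF refl]) (simp only: f)
    finally have "mon_eval f t = (\<Prod>j\<in>{1..m}. single (a j) 1 ^ lookup t j)" .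
    thus ?thesis by (simp add: T_def single_power prod_single)
  qed
  have "eval_at f P = (\<Sum>t\<in>keys P. single (T t) (lookup P t))"
    unfolding eval_at_superset[OF finite_keys order_refl]
    by (rule sum.cong) (simp_all add: mon Const_mult_single)
  hence zero: "(\<Sum>s\<in>keys P. lookup P s when T s = u) = 0" for u
    using eval by (metis (no_types, lifting) lookup_sum lookup_single lookup_zero sum.cong)
  have "keys P = {}"
  proof (rule ccontr)
    assume "keys P \<noteq> {}"
    then obtain t where t: "t \<in> keys P" by blast
    \<comment> \<open>Injectivity of \<open>T\<close> leaves only the summand
      \<open>s = t\<close>.\<close>
    have "(\<Sum>s\<in>keys P. lookup P s when T s = T t) = (\<Sum>s\<in>keys P. if s = t then lookup P s else 0)"
      by (rule sum.cong[OF refl]) (use inj t in \<open>auto simp: when_def dest: inj_onD\<close>)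
    also have "\<dots> = lookup P t" using t by simp
    finally show False using zero[of "T t"] t by (simp add: in_keys_iff)
  qed
  thus "P = 0" by simp
qed

section \<open>Monomials in a family of elements\<close>

lemma is_monomial_in_Const: "is_monomial_in m g (Const c)"
  unfolding is_monomial_in_def by (rule exI[of _ c], rule exI[of _ "\<lambda>_. 0"]) simp

lemma is_monomial_in_generator:
  assumes "j \<in> {1..m}"
  shows "is_monomial_in m g (g j)"
proof -
  have "(\<Prod>i\<in>{1..m}. g i ^ (if i = j then 1 else 0)) = (\<Prod>i\<in>{1..m}. if i = j then g i else 1)"
    by (rule prod.cong) auto
  hence "g j = Const 1 * (\<Prod>i\<in>{1..m}. g i ^ (if i = j then 1 else 0))"
    using assms by simp
  thus ?thesis unfolding is_monomial_in_def by (intro exI)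
qed

lemma is_monomial_in_mult:
  assumes "is_monomial_in m g p" "is_monomial_in m g q"
  shows "is_monomial_in m g (p * q)"
proof -
  obtain c a d b where "p = Const c * (\<Prod>j\<in>{1..m}. g j ^ a j)"
    "q = Const d * (\<Prod>j\<in>{1..m}. g j ^ b j)"
    using assms by (auto simp: is_monomial_in_def)
  hence "p * q = Const (c * d) * (\<Prod>j\<in>{1..m}. g j ^ (a j + b j))"
    by (simp add: Const_mult power_add prod.distrib mult_ac)
  thus ?thesis unfolding is_monomial_in_def by (intro exI)
qed

lemma is_monomial_in_power: "is_monomial_in m g p \<Longrightarrow> is_monomial_in m g (p ^ k)"
  using is_monomial_in_Const[of m g 1] by (induction k) (simp_all add: is_monomial_in_mult)

lemma is_monomial_in_prod:
  "(\<And>j. j \<in> J \<Longrightarrow> is_monomial_in m g (h j)) \<Longrightarrow> is_monomial_in m g (\<Prod>j\<in>J. h j)"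
  using is_monomial_in_Const[of m g 1]
  by (induction J rule: infinite_finite_induct) (simp_all add: is_monomial_in_mult)

lemma is_monomial_in_adjoin:
  assumes "is_monomial_in m g p"
  shows "p \<in> adjoin (g ` {1..m})"
proof -
  note S = subalgebra_adjoin[of "g ` {1..m}"]
  obtain c a where "p = Const c * (\<Prod>j\<in>{1..m}. g j ^ a j)"
    using assms by (auto simp: is_monomial_in_def)
  thus ?thesis
    by (simp only:) (intro subalgebra_mult[OF S] subalgebra_Const[OF S] subalgebra_prod[OF S]
        subalgebra_power[OF S] adjoin_inc imageI)
qed

section \<open>Principal ideals\<close>

interpretation ring_module: module "(*) :: 'r::comm_ring_1 \<Rightarrow> 'r \<Rightarrow> 'r"
  by unfold_locales (simp_all add: algebra_simps)

lemma ideal_gen_singleton: "ideal_gen {a} = {b. a dvd b}"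
  by (auto simp: ideal_gen_def ring_module.span_singleton dvd_def mult.commute image_iff)

text \<open>Since \<open>e = e * e\<close>, the generator is itself a product of two elements of its
  ideal.\<close>

lemma idempotent_ideal_gen:
  assumes "e\<^sup>2 = e"
  shows "idempotent_ideal (ideal_gen {e})"
  unfolding idempotent_ideal_def
proof
  let ?P = "{a * b | a b. a \<in> ideal_gen {e} \<and> b \<in> ideal_gen {e}}"
  show sub: "module.subspace (*) (ideal_gen {e})" unfolding ideal_gen_def by simp
  show "ideal_gen ?P = ideal_gen {e}"
  proof
    have "?P \<subseteq> ideal_gen {e}" by (auto simp: ideal_gen_singleton)
    thus "ideal_gen ?P \<subseteq> ideal_gen {e}"
      using sub ring_module.span_minimal unfolding ideal_gen_def by blast
    have "e = e * e" using assms by (simp add: power2_eq_square)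
    moreover have "e \<in> ideal_gen {e}" by (simp add: ideal_gen_singleton)
    ultimately have "e \<in> ?P" by blast
    hence "{e} \<subseteq> ?P" by blast
    thus "ideal_gen {e} \<subseteq> ideal_gen ?P"
      unfolding ideal_gen_def by (rule ring_module.span_mono)
  qed
qed

section \<open>Monomial retractions\<close>

text \<open>An index \<open>i\<close> with \<open>\<phi> (X i) = 0\<close> is given the coefficient \<open>lam i = 0\<close> and the zero exponent
  vector, so that the two idempotency relations below hold for all indices.\<close>

locale retraction_data =
  fixes n :: nat and \<phi> :: "'r::comm_ring_1 mpol \<Rightarrow> 'r mpol"
    and lam :: "nat \<Rightarrow> 'r" and ex :: "nat \<Rightarrow> nat \<Rightarrow>\<^sub>0 nat"
  assumes retr: "retraction n \<phi>"
    and phi_X: "i \<in> {1..n} \<Longrightarrow> \<phi> (X i) = single (ex i) (lam i)"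
    and keys_ex: "i \<in> {1..n} \<Longrightarrow> keys (ex i) \<subseteq> {1..n}"
    and ex_0: "i \<in> {1..n} \<Longrightarrow> lam i = 0 \<Longrightarrow> ex i = 0"
begin

section \<open>Relations between coefficients and exponents\<close>

lemma hom: "alg_hom_on (polys n) \<phi>"
  using retr by (simp add: retraction_def)

lemma phi_single:
  assumes "keys t \<subseteq> {1..n}"
  shows "\<phi> (single t c) = Const c * (\<Prod>k\<in>{1..n}. \<phi> (X k) ^ lookup t k)"
  using hom_eq_eval_at[OF hom single_in_polys[OF assms], of c]
  by (simp add: eval_at_single mon_eval_superset[OF _ assms])

text \<open>This is \<open>\<phi> (\<phi> (X i)) = \<phi> (X i)\<close>, with the outer
  \<open>\<phi>\<close> evaluated on \<open>single (ex i) (lam i)\<close>.\<close>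

lemma phi_X_idem:
  assumes "i \<in> {1..n}"
  shows "\<phi> (X i) = Const (lam i) * (\<Prod>k\<in>{1..n}. \<phi> (X k) ^ lookup (ex i) k)"
proof -
  have "X i \<in> (polys n :: 'r mpol set)" by (rule X_in_polys[OF assms])
  hence "\<phi> (X i) = \<phi> (\<phi> (X i))" using retr by (simp add: retraction_def)
  thus ?thesis using phi_single[OF keys_ex[OF assms], of "lam i"] by (simp add: phi_X[OF assms])
qed

text \<open>The coefficient of the image of \<open>single (ex i) 1\<close> under
  \<open>\<phi>\<close>. It is shown to be idempotent for \<open>i\<close> in the support.\<close>

definition e :: "nat \<Rightarrow> 'r" where
  "e i = (\<Prod>k\<in>{1..n}. lam k ^ lookup (ex i) k)"

text \<open>Both sides of \<open>phi_X_idem\<close> are single terms; comparing coefficients and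
  exponents yields \<open>lam_e\<close> and \<open>ex_idem\<close>.\<close>

lemma idem_single:
  assumes i: "i \<in> {1..n}"
  shows "single (ex i) (lam i) =
    single (\<Sum>k\<in>{1..n}. of_nat (lookup (ex i) k) * ex k) (lam i * e i)"
proof -
  have "(\<Prod>k\<in>{1..n}. \<phi> (X k) ^ lookup (ex i) k) =
      (\<Prod>k\<in>{1..n}. single (of_nat (lookup (ex i) k) * ex k) (lam k ^ lookup (ex i) k))"
    by (rule prod.cong) (simp_all add: phi_X single_power)
  thus ?thesis
    using phi_X_idem[OF i] by (simp add: phi_X[OF i] prod_single Const_mult_single e_def)
qed

lemma lam_e:
  assumes "i \<in> {1..n}"
  shows "lam i * e i = lam i"
proof (cases "lam i = 0")
  case False
  with idem_single[OF assms] show ?thesis by (metis single_eq_iff single_zero)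
qed simp

lemma ex_idem:
  assumes i: "i \<in> {1..n}"
  shows "lookup (ex i) l = (\<Sum>k\<in>{1..n}. lookup (ex i) k * lookup (ex k) l)"
proof (cases "lam i = 0")
  case True
  thus ?thesis by (simp add: ex_0[OF i])
next
  case False
  hence "ex i = (\<Sum>k\<in>{1..n}. of_nat (lookup (ex i) k) * ex k)"
    using idem_single[OF i] single_eq_iff lam_e[OF i] by metis
  hence "lookup (ex i) l = lookup (\<Sum>k\<in>{1..n}. of_nat (lookup (ex i) k) * ex k) l" by simp
  thus ?thesis by (simp add: lookup_sum lookup_of_nat_mult)
qed

text \<open>Every exponent vector of a product \<open>X i * q\<close> has a positive entry at
  \<open>i\<close>, whatever the polynomial \<open>q\<close> is; conversely, lowering that entry by
  one gives a cofactor. A positive entry also forces \<open>lam i\<close> to be nonzero, by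
  \<open>ex_0\<close>.\<close>

lemma support_iff: "i \<in> support n \<phi> \<longleftrightarrow> i \<in> {1..n} \<and> lookup (ex i) i > 0"
proof
  assume i: "i \<in> support n \<phi>"
  hence iN: "i \<in> {1..n}" and mon: "is_monomial n (\<phi> (X i))" by (auto simp: support_def)
  obtain q where q: "\<phi> (X i) = X i * q" using i by (auto simp: support_def)
  have "lam i \<noteq> 0" using mon single_eq_iff unfolding is_monomial_iff phi_X[OF iN]
    by (metis single_zero)
  hence "ex i \<in> keys (X i * q)" using q phi_X[OF iN] by (metis keys_single singletonI)
  then obtain b where "ex i = single i 1 + b"
    using keys_mult[of "X i" q] by (auto simp: X_def)
  thus "i \<in> {1..n} \<and> lookup (ex i) i > 0" using iN by (simp add: lookup_add)
next
  assume i: "i \<in> {1..n} \<and> lookup (ex i) i > 0"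
  hence iN: "i \<in> {1..n}" by simp
  have lam: "lam i \<noteq> 0" using i ex_0 by force
  have mon: "is_monomial n (\<phi> (X i))"
    unfolding is_monomial_iff using lam keys_ex[OF iN] phi_X[OF iN] by blast
  let ?b = "ex i - single i 1"
  have "ex i = single i 1 + ?b"
    by (rule poly_mapping_eqI)
      (use i in \<open>auto simp: lookup_add lookup_minus lookup_single when_def\<close>)
  hence "\<phi> (X i) = X i * single ?b (lam i)"
    unfolding phi_X[OF iN] by (simp add: X_def mult_single)
  moreover have "single ?b (lam i) \<in> polys n"
  proof (rule single_in_polys)
    show "keys ?b \<subseteq> {1..n}" using keys_ex[OF iN]
      by (auto simp: in_keys_iff lookup_minus)
  qed
  ultimately show "i \<in> support n \<phi>" using iN mon unfolding support_def by blast
qed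

text \<open>The exponent matrix is idempotent by \<open>ex_idem\<close>. The second claim says that
  all variables of \<open>\<phi> (X s)\<close> other than \<open>X s\<close> have constant
  images.\<close>

lemma support_diag: "s \<in> support n \<phi> \<Longrightarrow> lookup (ex s) s = 1"
  and support_ex_0:
    "s \<in> support n \<phi> \<Longrightarrow> k \<noteq> s \<Longrightarrow> lookup (ex s) k > 0 \<Longrightarrow> ex k = 0"
proof -
  assume s: "s \<in> support n \<phi>"
  hence sN: "s \<in> {1..n}" "lookup (ex s) s > 0" by (auto simp: support_iff)
  note d = idempotent_matrix_diag[of "{1..n}" "\<lambda>i. lookup (ex i)", OF _ ex_idem sN]
  show "lookup (ex s) s = 1" using d(1) by simp
  assume k: "k \<noteq> s" "lookup (ex s) k > 0"
  have "k \<in> keys (ex s)" using k(2) by (simp add: in_keys_iff)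
  hence "k \<in> {1..n}" using keys_ex[OF sN(1)] by blast
  with d(2) k show "ex k = 0" by (intro poly_mapping_eqI) simp
qed

lemma lam_dvd_e:
  assumes "k \<in> {1..n}" "lookup (ex i) k > 0"
  shows "lam k dvd e i"
proof -
  have "lam k dvd lam k ^ lookup (ex i) k" using assms(2) by (simp add: dvd_power)
  also have "\<dots> dvd e i" unfolding e_def by (rule dvd_prodI) (use assms in auto)
  finally show ?thesis .
qed

text \<open>\<open>X s\<close> occurs in its own image, so \<open>lam s\<close> is a factor of
  \<open>e s\<close>, while \<open>lam_e\<close> gives the converse divisibility. Writing
  \<open>e s = lam s * u\<close>, \<open>lam_e\<close> gives
  \<open>e s * e s = lam s * e s * u = e s\<close>.\<close>

lemma
  assumes s: "s \<in> support n \<phi>"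
  shows lam_support_nonzero: "lam s \<noteq> 0"
    and lam_dvd_e_support: "lam s dvd e s"
    and e_dvd_lam: "e s dvd lam s"
    and e_nonzero: "e s \<noteq> 0"
    and e_idem: "e s * e s = e s"
proof -
  have sN: "s \<in> {1..n}" "lookup (ex s) s > 0" using s by (auto simp: support_iff)
  show lam: "lam s \<noteq> 0" using sN ex_0 by force
  show dvd: "lam s dvd e s" using lam_dvd_e sN by blast
  show "e s dvd lam s" using lam_e[OF sN(1)] by (metis dvd_triv_right)
  show "e s \<noteq> 0" using lam lam_e[OF sN(1)] by auto
  obtain u where "e s = lam s * u" using dvd by (elim dvdE)
  thus "e s * e s = e s" using lam_e[OF sN(1)] by (metis mult.assoc mult.commute)
qed

text \<open>Only variables occurring in some image are covered, since
  \<open>idempotent_matrix_row\<close> needs row \<open>k\<close> to be used by row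
  \<open>i\<close>. It makes a nonzero row \<open>k\<close> equal to the row of some
  \<open>s\<close> in the support.\<close>

lemma phi_X_factor:
  assumes i: "i \<in> {1..n}" and k: "k \<in> {1..n}" "lookup (ex i) k > 0"
  shows "\<phi> (X k) \<in> range Const \<or>
    (\<exists>s\<in>support n \<phi>. \<exists>c. \<phi> (X k) = Const c * (Const (e s) * single (ex s) 1))"
proof (cases "ex k = 0")
  case True
  thus ?thesis using phi_X[OF k(1)] by (simp add: Const_def)
next
  case False
  then obtain l where "lookup (ex k) l > 0"
    by (metis gr0I lookup_zero poly_mapping_eqI)
  from idempotent_matrix_row[of "{1..n}" "\<lambda>i. lookup (ex i)", OF _ ex_idem i k this]
  obtain s where s: "s \<in> {1..n}" "lookup (ex s) s = 1" "lookup (ex k) s = 1"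
    "\<And>l. lookup (ex k) l = lookup (ex s) l" by auto
  have sup: "s \<in> support n \<phi>" using s by (simp add: support_iff)
  \<comment> \<open>\<open>X s\<close> occurs in the image of \<open>X k\<close>, so
    \<open>lam s\<close> divides \<open>e k\<close> and hence \<open>lam k = lam k * e k\<close>.
    Then \<open>lam k\<close> absorbs \<open>e s\<close> because \<open>lam s\<close> does.\<close>
  have "lam s dvd lam k"
    using lam_dvd_e[OF s(1), of k] s(3) lam_e[OF k(1)] by (metis dvd_mult zero_less_one)
  then obtain v where "lam k = lam s * v" by (elim dvdE)
  hence "lam k * e s = lam k" using lam_e[OF s(1)] by (metis mult.assoc mult.commute)
  moreover have "ex k = ex s" using s(4) by (rule poly_mapping_eqI)
  ultimately have "\<phi> (X k) = Const (lam k) * (Const (e s) * single (ex s) 1)"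
    by (simp add: phi_X[OF k(1)] Const_mult_single)
  with sup show ?thesis by blast
qed

text \<open>\<open>phi_X_factor\<close> need not apply to \<open>X i\<close> itself, but
  \<open>phi_X_idem\<close> writes its image through the images of the variables occurring in
  it.\<close>

lemma phi_X_monomial_in:
  fixes ind :: "nat \<Rightarrow> nat"
  assumes ind: "ind ` {1..m} = support n \<phi>" and i: "i \<in> {1..n}"
  shows "is_monomial_in m (\<lambda>j. Const (e (ind j)) * single (ex (ind j)) 1) (\<phi> (X i))"
    (is "is_monomial_in m ?g _")
proof -
  have "is_monomial_in m ?g (\<phi> (X k) ^ lookup (ex i) k)" if k: "k \<in> {1..n}" for k
  proof (cases "lookup (ex i) k = 0")
    case True
    thus ?thesis using is_monomial_in_Const[of m ?g 1] by simp
  next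
    case False
    hence "\<phi> (X k) \<in> range Const \<or>
      (\<exists>s\<in>support n \<phi>. \<exists>c. \<phi> (X k) = Const c * (Const (e s) * single (ex s) 1))"
      by (intro phi_X_factor[OF i k]) simp
    hence "\<phi> (X k) \<in> range Const \<or> (\<exists>j\<in>{1..m}. \<exists>c. \<phi> (X k) = Const c * ?g j)"
      unfolding ind[symmetric] by blast
    hence "is_monomial_in m ?g (\<phi> (X k))"
    proof
      assume "\<exists>j\<in>{1..m}. \<exists>c. \<phi> (X k) = Const c * ?g j"
      then obtain j c where j: "j \<in> {1..m}" and eq: "\<phi> (X k) = Const c * ?g j" by blast
      show ?thesis unfolding eq
        by (rule is_monomial_in_mult[OF is_monomial_in_Const])
          (rule is_monomial_in_generator[OF j])
    qed (auto intro: is_monomial_in_Const)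
    thus ?thesis by (rule is_monomial_in_power)
  qed
  thus ?thesis
    by (subst phi_X_idem[OF i]) (intro is_monomial_in_mult is_monomial_in_Const is_monomial_in_prod)
qed

text \<open>The inclusions run in a circle: the \<open>\<phi> (X i)\<close> are monomials in the
  \<open>e s * X^(ex s)\<close>; each of these is a constant multiple of
  \<open>\<phi> (X s)\<close>, as \<open>lam s\<close> divides \<open>e s\<close>; and the
  \<open>\<phi> (X s)\<close> lie in the image.\<close>

lemma image_eq_adjoin:
  fixes ind :: "nat \<Rightarrow> nat"
  assumes ind: "ind ` {1..m} = support n \<phi>"
  shows "\<phi> ` polys n = adjoin ((\<lambda>j. Const (e (ind j)) * single (ex (ind j)) 1) ` {1..m})"
      (is "?A = adjoin (?g ` _)")
    and "\<phi> ` polys n = adjoin ((\<lambda>j. \<phi> (X (ind j))) ` {1..m})" (is "_ = ?B")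
proof -
  have indN: "ind j \<in> {1..n}" if "j \<in> {1..m}" for j
    using that ind support_iff by blast
  have "?A \<subseteq> adjoin (?g ` {1..m})"
    unfolding hom_image[OF hom]
    using phi_X_monomial_in[OF ind] is_monomial_in_adjoin by (intro adjoin_subset) blast
  moreover have "adjoin (?g ` {1..m}) \<subseteq> ?B"
  proof (rule adjoin_subset, rule image_subsetI)
    fix j assume j: "j \<in> {1..m}"
    obtain u where "e (ind j) = lam (ind j) * u"
      using lam_dvd_e_support j ind by (metis dvdE image_eqI)
    hence "?g j = Const u * \<phi> (X (ind j))"
      by (simp add: phi_X[OF indN[OF j]] Const_mult_single mult.commute[of u])
    thus "?g j \<in> ?B"
      using subalgebra_mult[OF subalgebra_adjoin subalgebra_Const[OF subalgebra_adjoin]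
          adjoin_inc[OF imageI[OF j]]] by simp
  qed
  moreover have "?B \<subseteq> ?A"
    unfolding hom_image[OF hom] using indN by (intro adjoin_subset) (auto intro: adjoin_inc)
  ultimately show "?A = adjoin (?g ` {1..m})" "?A = ?B" by blast+
qed

text \<open>The support indices themselves serve as marks: if \<open>X (ind k)\<close> occurred in
  \<open>ex (ind j)\<close> for another \<open>j\<close>, then \<open>ex (ind k)\<close> would be
  \<open>0\<close>, against \<open>support_diag\<close>.\<close>

lemma independent:
  assumes ind: "bij_betw ind {1..m} (support n \<phi>)"
  shows "alg_independent m (\<lambda>j. single (ex (ind j)) (1 :: 'r))"
proof (rule monomials_alg_independent[where x = ind])
  fix j k assume jk: "j \<in> {1..m}" "k \<in> {1..m}"
  hence sup: "ind j \<in> support n \<phi>" "ind k \<in> support n \<phi>" using ind by (auto simp: bij_betw_def)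
  show "lookup (ex (ind j)) (ind k) = (if j = k then 1 else 0)"
  proof (cases "j = k")
    case True
    thus ?thesis using support_diag sup by simp
  next
    case False
    hence "ind k \<noteq> ind j" using ind jk by (auto simp: bij_betw_def dest: inj_onD)
    moreover have "ex (ind k) \<noteq> 0" using support_diag[OF sup(2)] by auto
    ultimately have "lookup (ex (ind j)) (ind k) = 0" using support_ex_0[OF sup(1)] by blast
    thus ?thesis using False by simp
  qed
qed simp

text \<open>The cofactor is \<open>X^(ex s)\<close> with one \<open>X s\<close> removed. As
  \<open>X s\<close> has exponent exactly 1, it is gone from \<open>M\<close>, so every variable of
  \<open>M\<close> has a constant image; this constant divides \<open>e s\<close> and is therefore
  nonzero.\<close>

lemma cofactor:
  assumes s: "s \<in> support n \<phi>"
  shows "\<exists>M. is_monomial n M \<and> single (ex s) (1 :: 'r) = X s * M \<and>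
    (\<forall>k\<in>indets M. \<exists>r :: 'r. r \<noteq> 0 \<and> \<phi> (X k) = Const r)"
proof (rule exI, intro conjI ballI)
  let ?b = "ex s - single s 1"
  have sN: "s \<in> {1..n}" and diag: "lookup (ex s) s = 1"
    using s support_iff support_diag by auto
  have keys_b: "k \<in> {1..n} \<and> k \<noteq> s \<and> lookup (ex s) k > 0" if "k \<in> keys ?b" for k
  proof -
    have "k \<noteq> s \<and> lookup (ex s) k > 0" using that diag
      by (auto simp: in_keys_iff lookup_minus lookup_single when_def split: if_splits)
    moreover from this have "k \<in> keys (ex s)" by (simp add: in_keys_iff)
    ultimately show ?thesis using keys_ex[OF sN] by blast
  qed
  show "is_monomial n (single ?b (1 :: 'r))"
    unfolding is_monomial_iff using keys_b by (intro exI conjI) (rule one_neq_zero, auto)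
  have "ex s = single s 1 + ?b"
    by (rule poly_mapping_eqI)
      (use diag in \<open>auto simp: lookup_add lookup_minus lookup_single when_def\<close>)
  thus "single (ex s) (1 :: 'r) = X s * single ?b 1" by (simp add: X_def mult_single)
  fix k assume "k \<in> indets (single ?b (1 :: 'r))"
  hence "k \<in> keys ?b" by (simp add: indets_def)
  hence k: "k \<in> {1..n}" "k \<noteq> s" "lookup (ex s) k > 0" using keys_b by auto
  show "\<exists>r :: 'r. r \<noteq> 0 \<and> \<phi> (X k) = Const r"
  proof (intro exI conjI)
    show "\<phi> (X k) = Const (lam k)"
      using phi_X[OF k(1)] support_ex_0[OF s k(2,3)] by (simp add: Const_def)
    show "lam k \<noteq> 0" using lam_dvd_e[OF k(1,3)] e_nonzero[OF s] by auto
  qed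
qed

lemma e_eq_1_if_monic:
  assumes s: "s \<in> support n \<phi>" and monic: "is_monic_monomial n (\<phi> (X s))"
  shows "e s = 1"
proof -
  have sN: "s \<in> {1..n}" using s by (simp add: support_iff)
  obtain t where "single (ex s) (lam s) = single t 1"
    using monic phi_X[OF sN] by (auto simp: is_monic_monomial_iff)
  hence "lam s = 1" by (simp add: single_eq_iff)
  thus ?thesis using lam_e[OF sN] by simp
qed

end

lemma monomial_retraction_data:
  assumes "monomial_retraction n \<phi>"
  obtains lam ex where "retraction_data n \<phi> lam ex"
proof -
  have "\<exists>c t. i \<in> {1..n} \<longrightarrow>
      \<phi> (X i) = single t c \<and> keys t \<subseteq> {1..n} \<and> (c = 0 \<longrightarrow> t = 0)" for i
  proof (cases "i \<in> {1..n}")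
    case True
    hence "\<phi> (X i) = 0 \<or> is_monomial n (\<phi> (X i))"
      using assms by (auto simp: monomial_retraction_def)
    thus ?thesis
    proof
      assume "\<phi> (X i) = 0"
      thus ?thesis by (intro exI[of _ 0]) simp
    next
      assume "is_monomial n (\<phi> (X i))"
      thus ?thesis by (auto simp: is_monomial_iff)
    qed
  qed blast
  then obtain lam ex where "\<And>i. i \<in> {1..n} \<Longrightarrow>
      \<phi> (X i) = single (ex i) (lam i) \<and> keys (ex i) \<subseteq> {1..n} \<and> (lam i = 0 \<longrightarrow> ex i = 0)"
    by metis
  with assms show ?thesis
    by (intro that[of lam ex]) (auto simp: retraction_data_def monomial_retraction_def)
qed

theorem theorem3p6:
  fixes n m :: nat
    and \<phi> :: "'r::comm_ring_1 mpol \<Rightarrow> 'r mpol"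
    and A :: "'r mpol set"
    and ind :: "nat \<Rightarrow> nat"
  assumes "monomial_retraction n \<phi>"
    and "A = \<phi> ` polys n"
    and "bij_betw ind {1..m} (support n \<phi>)"
  shows "m \<le> n \<and>
    (\<exists>(e :: nat \<Rightarrow> 'r) (f :: nat \<Rightarrow> 'r mpol).
       (\<forall>j\<in>{1..m}. e j \<noteq> 0 \<and> (e j)^2 = e j \<and> f j \<in> polys n) \<and>
       A = adjoin ((\<lambda>j. Const (e j) * f j) ` {1..m}) \<and>
       ((\<forall>j\<in>{1..m}. is_monic_monomial n (f j)) \<and> alg_independent m f) \<and>
       ((\<forall>j\<in>{1..m}.
           (\<exists>l :: 'r. \<phi> (X (ind j)) = Const l * f j \<and>
              ideal_gen {l} = ideal_gen {e j} \<and>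
              ideal_gen {l} \<noteq> {0} \<and> idempotent_ideal (ideal_gen {l})) \<and>
           (\<exists>M. is_monomial n M \<and> f j = X (ind j) * M \<and>
              (\<forall>k\<in>indets M. \<exists>r :: 'r. r \<noteq> 0 \<and> \<phi> (X k) = Const r))) \<and>
        A = adjoin ((\<lambda>j. \<phi> (X (ind j))) ` {1..m})) \<and>
       (\<forall>i\<in>{1..n} - support n \<phi>.
           \<phi> (X i) \<in> range Const \<or>
           (\<phi> (X i) \<noteq> 0 \<and> is_monomial_in m (\<lambda>j. Const (e j) * f j) (\<phi> (X i))))) \<and>
    ((\<forall>e :: 'r. e^2 = e \<longrightarrow> e = 0 \<or> e = 1) \<or> monic_monomial_retraction n \<phi> \<longrightarrow>
       is_polynomial_ring A m)"
proof -
  obtain lam ex where "retraction_data n \<phi> lam ex"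
    using monomial_retraction_data[OF assms(1)] by blast
  then interpret retraction_data n \<phi> lam ex .
  define E where "E j = e (ind j)" for j
  define f where "f j = single (ex (ind j)) (1 :: 'r)" for j
  have ind: "ind ` {1..m} = support n \<phi>" using assms(3) by (simp add: bij_betw_def)
  have sup: "ind j \<in> support n \<phi>" if "j \<in> {1..m}" for j using that ind by blast
  have indN: "ind j \<in> {1..n}" if "j \<in> {1..m}" for j using sup[OF that] support_iff by blast
  have image: "A = adjoin ((\<lambda>j. Const (E j) * f j) ` {1..m})"
    "A = adjoin ((\<lambda>j. \<phi> (X (ind j))) ` {1..m})"
    using image_eq_adjoin[OF ind] by (simp_all add: assms(2) E_def f_def)
  have indep: "alg_independent m f"
    using independent[OF assms(3)] by (simp add: f_def[abs_def])
  have le: "m \<le> n"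
  proof -
    have "card (support n \<phi>) = m" using bij_betw_same_card[OF assms(3)] by simp
    moreover have "support n \<phi> \<subseteq> {1..n}" by (auto simp: support_def)
    ultimately show ?thesis by (metis card_atLeastAtMost card_mono diff_Suc_1 finite_atLeastAtMost)
  qed
  have idem: "E j \<noteq> 0 \<and> (E j)\<^sup>2 = E j \<and> f j \<in> polys n" if "j \<in> {1..m}" for j
    using e_nonzero[OF sup[OF that]] e_idem[OF sup[OF that]] keys_ex[OF indN[OF that]]
    by (simp add: E_def f_def power2_eq_square single_in_polys)
  have monic: "is_monic_monomial n (f j)" if "j \<in> {1..m}" for j
    using keys_ex[OF indN[OF that]] unfolding is_monic_monomial_iff f_def by blast
  have coeff: "\<exists>l. \<phi> (X (ind j)) = Const l * f j \<and> ideal_gen {l} = ideal_gen {E j} \<and>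
      ideal_gen {l} \<noteq> {0} \<and> idempotent_ideal (ideal_gen {l})" if "j \<in> {1..m}" for j
  proof -
    note s = sup[OF that]
    have "\<phi> (X (ind j)) = Const (lam (ind j)) * f j"
      by (simp add: phi_X[OF indN[OF that]] f_def Const_mult_single)
    moreover have eq: "ideal_gen {lam (ind j)} = ideal_gen {E j}"
      unfolding ideal_gen_singleton E_def using lam_dvd_e_support[OF s] e_dvd_lam[OF s]
      by (blast intro: dvd_trans)
    moreover have "lam (ind j) \<in> ideal_gen {lam (ind j)}" by (simp add: ideal_gen_singleton)
    with lam_support_nonzero[OF s] have "ideal_gen {lam (ind j)} \<noteq> {0}" by blast
    moreover have "idempotent_ideal (ideal_gen {lam (ind j)})"
      unfolding eq E_def
      by (rule idempotent_ideal_gen) (simp add: power2_eq_square e_idem[OF s])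
    ultimately show ?thesis by blast
  qed
  have cofac: "\<exists>M. is_monomial n M \<and> f j = X (ind j) * M \<and>
      (\<forall>k\<in>indets M. \<exists>r :: 'r. r \<noteq> 0 \<and> \<phi> (X k) = Const r)" if "j \<in> {1..m}" for j
    using cofactor[OF sup[OF that]] by (simp add: f_def)
  have outside: "\<phi> (X i) \<in> range Const \<or>
      (\<phi> (X i) \<noteq> 0 \<and> is_monomial_in m (\<lambda>j. Const (E j) * f j) (\<phi> (X i)))"
    if "i \<in> {1..n} - support n \<phi>" for i
  proof -
    \<comment> \<open>Every image is a monomial in the generators, and the image \<open>0\<close>
      falls under the constants, so the two alternatives are exhaustive.\<close>
    have "(0 :: 'r mpol) \<in> range Const" by (metis Const_0 rangeI)
    thus ?thesis using phi_X_monomial_in[OF ind, of i] that unfolding E_def f_def by force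
  qed
  have poly: "is_polynomial_ring A m"
    if triv: "(\<forall>e :: 'r. e^2 = e \<longrightarrow> e = 0 \<or> e = 1) \<or> monic_monomial_retraction n \<phi>"
  proof -
    have "E j = 1" if j: "j \<in> {1..m}" for j
      using triv
    proof
      assume "\<forall>e :: 'r. e^2 = e \<longrightarrow> e = 0 \<or> e = 1"
      thus ?thesis
        using e_nonzero[OF sup[OF j]] e_idem[OF sup[OF j]]
        unfolding E_def power2_eq_square by blast
    next
      assume "monic_monomial_retraction n \<phi>"
      \<comment> \<open>A variable of the support has a nonzero image, which excludes the
        alternative \<open>0\<close>.\<close>
      hence "is_monic_monomial n (\<phi> (X (ind j)))"
        using indN[OF j] lam_support_nonzero[OF sup[OF j]] phi_X[OF indN[OF j]]
        unfolding monic_monomial_retraction_def by (metis single_eq_iff single_zero)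
      thus ?thesis using e_eq_1_if_monic[OF sup[OF j]] by (simp add: E_def)
    qed
    \<comment> \<open>With all \<open>E j\<close> equal to 1 the generators are the independent
      \<open>f j\<close> themselves.\<close>
    hence "(\<lambda>j. Const (E j) * f j) ` {1..m} = f ` {1..m}" by (intro image_cong) simp_all
    thus ?thesis using image(1) alg_independent_is_polynomial_ring[OF indep] by simp
  qed
  show ?thesis
  proof (intro conjI exI[of _ E] exI[of _ f] impI)
    show "\<forall>j\<in>{1..m}. E j \<noteq> 0 \<and> (E j)\<^sup>2 = E j \<and> f j \<in> polys n" using idem by blast
  qed (rule le image indep poly ballI[OF monic] ballI[OF outside]
      ballI[OF conjI[OF coeff cofac]] | assumption)+
qed

end
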